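(* Let $p>1/2$, $\epsilon\in(0,1)$ and let $m\ge 1$ be an integer. Let $t_n=2^n$ for $n\ge 0$ and let $(\beta_n)_{n\ge 0}$ be a sequence of positive real numbers with $\beta_n=O(2^{-2pn})$ as $n\to\infty$, such that $$4^p-\epsilon<\frac{\beta_n}{\beta_{n+1}}<4^p+\epsilon\qquad\text{for all } n\ge m.$$ Let $F^*=(F_n^* )_{n\ge0}$ be the solution of the infinite-horizon problem $$\min_{F}\ \Big(\sum_{n=0}^{\infty}\frac{\beta_n}{F_n}\Big)\Big(\sum_{n=0}^{\infty}t_nF_n\Big)\quad\text{s.t. } F_i\ge F_{i+1}\ \forall i\ge0,\quad F_i>0\ \forall i\ge0,\quad F_0=1,$$ and let $F^*(m)=(F_0^*(m),\dots,F_m^*(m))$ be the solution of the $m$-truncated problem $$\min_{F}\ \Big(\sum_{n=0}^{m}\frac{\beta_n}{F_n}\Big)\Big(\sum_{n=0}^{m}t_nF_n\Big)\quad\text{s.t. } F_i\ge F_{i+1}\ (0\le i\le m-1),\quad F_i>0\ (0\le i\le m),\quad F_0=1.$$ Suppose that $F_{m-1}^*(m)\ne F_m^*(m)$. Then $$F_n^*=F_n^*(m),\quad n=0,1,\dots,m,$$ $$F_{n+1}^*=F_n^*\sqrt{\frac{\beta_{n+1}}{2\beta_n}},\quad n=m,m+1,\dots$$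
   Context: In the infinite-horizon problem, $F=(F_n)_{n\ge0}$ ranges over real sequences; in the $m$-truncated problem, $F=(F_0,\dots,F_m)$ ranges over real vectors. The infinite sums are sums of positive terms, so the objective takes values in $(0,+\infty]$. "The solution" of a problem means its minimizer. *)

theory Defs
  imports Complex_Main "HOL-Library.Extended_Nonnegative_Real" "HOL-Library.Landau_Symbols"
begin

definition feasible :: "(nat \<Rightarrow> real) \<Rightarrow> bool" where
  "feasible F \<longleftrightarrow> (\<forall>i. F i \<ge> F (Suc i)) \<and> (\<forall>i. F i > 0) \<and> F 0 = 1"

text \<open>The sums may diverge, hence values in \<^typ>\<open>ennreal\<close>. For positive \<open>\<beta>\<close>, \<open>t\<close> and feasible \<open>F\<close>
  all terms are positive, so \<^const>\<open>ennreal\<close> truncates nothing and no product \<open>0 * \<infinity>\<close> occurs.\<close>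

definition objective :: "(nat \<Rightarrow> real) \<Rightarrow> (nat \<Rightarrow> real) \<Rightarrow> (nat \<Rightarrow> real) \<Rightarrow> ennreal" where
  "objective \<beta> t F = (\<Sum>n. ennreal (\<beta> n / F n)) * (\<Sum>n. ennreal (t n * F n))"

text \<open>A vector \<open>(F\<^sub>0, \<dots>, F\<^sub>m)\<close> is represented by a function on \<^typ>\<open>nat\<close> whose values
  beyond \<open>m\<close> are arbitrary: neither the constraints nor the objective depend on them.\<close>

definition trunc_feasible :: "nat \<Rightarrow> (nat \<Rightarrow> real) \<Rightarrow> bool" where
  "trunc_feasible m F \<longleftrightarrow> (\<forall>i<m. F i \<ge> F (Suc i)) \<and> (\<forall>i\<le>m. F i > 0) \<and> F 0 = 1"

definition trunc_objective :: "nat \<Rightarrow> (nat \<Rightarrow> real) \<Rightarrow> (nat \<Rightarrow> real) \<Rightarrow> (nat \<Rightarrow> real) \<Rightarrow> real" where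
  "trunc_objective m \<beta> t F = (\<Sum>n=0..m. \<beta> n / F n) * (\<Sum>n=0..m. t n * F n)"

end

theory Submission
  imports Defs
begin

text \<open>Write \<open>A(F)\<close> for \<open>\<Sum>n. \<beta> n / F n\<close> and \<open>B(F)\<close> for \<open>\<Sum>n. t n * F n\<close>, and split each at \<open>m\<close> into a
  head and a tail. For every feasible \<open>F\<close>,
  \<open>A(F) * B(F) \<ge> (sqrt (A\<^sub>h * B\<^sub>h) + sqrt (A\<^sub>t * B\<^sub>t))\<^sup>2\<close> by Cauchy--Schwarz in the plane.
  Here \<open>A\<^sub>h * B\<^sub>h\<close> is the truncated objective, hence at least its minimum, and
  \<open>sqrt (A\<^sub>t * B\<^sub>t) \<ge> \<Sum>n>m. sqrt (\<beta> n * t n)\<close> by Cauchy--Schwarz for series. This yields a lower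
  bound that does not depend on \<open>F\<close> (\<open>objective_lower_bound\<close>).

  The claimed solution \<open>G\<close> consists of the truncated minimizer \<open>Fm\<close> up to \<open>m\<close> and a multiple of
  \<open>sqrt (\<beta> n / t n)\<close> from \<open>m\<close> on. The tail estimate is then an equality. The planar one is an
  equality if the ratio \<open>A / B\<close> is the same for head and tail, and this is exactly the vanishing of
  the derivative of the truncated objective in its last coordinate at \<open>Fm\<close>
  (\<open>truncated_stationarity\<close>); that coordinate may move in both directions because
  \<open>Fm (m - 1) > Fm m\<close>. So \<open>G\<close> attains the bound (\<open>extend_by_root_attains_bound\<close>). It is
  feasible because \<open>\<beta> n / t n\<close> decreases from \<open>m\<close> on, and its value is finite because
  \<open>sqrt (\<beta> n * t n)\<close> decays geometrically for \<open>p > 1 / 2\<close>.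

  Finally, a minimizer of finite value is unique (\<open>minimizer_unique\<close>): the pointwise geometric mean
  of two distinct ones would be feasible with a smaller objective. Hence the given minimizer
  is \<open>G\<close>.\<close>

section \<open>The Cauchy--Schwarz inequality for positive series\<close>

text \<open>With \<open>l = sqrt (Y / X)\<close>, the mean inequality bounds \<open>sqrt (x n * y n)\<close> by
  \<open>(l * x n + y n / l) / 2\<close>, and these bounds sum to exactly \<open>sqrt (X * Y)\<close>. A single index at which
  \<open>l * x k \<noteq> y k / l\<close>, that is, at which \<open>x\<close> and \<open>y\<close> fail to have the ratio of their sums, makes
  the inequality strict.\<close>

lemma Cauchy_Schwarz_suminf:
  fixes x y :: "nat \<Rightarrow> real"
  assumes pos: "\<And>n. x n > 0" "\<And>n. y n > 0" and "summable x" "summable y"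
  shows summable_sqrt_mult: "summable (\<lambda>n. sqrt (x n * y n))"
    and suminf_sqrt_mult_le: "(\<Sum>n. sqrt (x n * y n)) \<le> sqrt (suminf x * suminf y)"
    and suminf_sqrt_mult_less:
      "x k * suminf y \<noteq> y k * suminf x \<Longrightarrow>
        (\<Sum>n. sqrt (x n * y n)) < sqrt (suminf x * suminf y)"
proof -
  define X Y where "X = suminf x" and "Y = suminf y"
  have X: "X > 0" and Y: "Y > 0"
    unfolding X_def Y_def using assms by (auto intro: suminf_pos)
  define l where "l = sqrt (Y / X)"
  have l: "l > 0" "l * l = Y / X" using X Y by (auto simp: l_def)
  define d where "d n = (l * x n + y n / l) / 2" for n
  have sum_d: "summable d"
    unfolding d_def by (intro summable_divide summable_add summable_mult assms)
  have le: "sqrt (x n * y n) \<le> d n" for n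
    using arith_geo_mean_sqrt[of "l * x n" "y n / l"] l pos[of n] by (simp add: d_def)
  show sum: "summable (\<lambda>n. sqrt (x n * y n))"
    by (rule summable_comparison_test'[OF sum_d, of 0]) (use le pos in \<open>simp add: less_imp_le\<close>)
  have "d sums ((l * X + Y / l) / 2)"
    unfolding d_def X_def Y_def
    by (intro sums_divide sums_add sums_mult summable_sums assms)
  then have "suminf d = (l * X + Y / l) / 2" by (simp add: sums_iff)
  also have "l * X = sqrt (X * Y)"
  proof (rule real_sqrt_unique[symmetric])
    have "(l * X)\<^sup>2 = (l * l) * X * X" by (simp add: power2_eq_square)
    then show "(l * X)\<^sup>2 = X * Y" using X by (simp add: l(2))
  qed (use l X in simp)
  also have "Y / l = sqrt (X * Y)"
  proof -
    have "Y / l = l * X" using l X by (simp add: field_simps)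
    then show ?thesis using \<open>l * X = sqrt (X * Y)\<close> by simp
  qed
  finally have sd: "suminf d = sqrt (suminf x * suminf y)" by (simp add: X_def Y_def)
  show "(\<Sum>n. sqrt (x n * y n)) \<le> sqrt (suminf x * suminf y)"
    unfolding sd[symmetric] by (intro suminf_le le sum sum_d)
  show "(\<Sum>n. sqrt (x n * y n)) < sqrt (suminf x * suminf y)"
    if neq: "x k * suminf y \<noteq> y k * suminf x"
  proof -
    have "sqrt (x k * y k) \<noteq> d k"
    proof
      assume "sqrt (x k * y k) = d k"
      then have "x k * y k = (d k)\<^sup>2"
        by (metis less_imp_le mult_pos_pos pos real_sqrt_pow2)
      then have "(l * x k - y k / l)\<^sup>2 = 0"
        using l by (simp add: d_def power2_eq_square field_simps)
      then have "l * l * x k = y k" using l(1) by (simp add: field_simps)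
      then have "x k * Y = y k * X" using X unfolding l(2) by (simp add: field_simps)
      then show False using neq by (simp add: X_def Y_def)
    qed
    then have "0 < (\<Sum>n. d n - sqrt (x n * y n))"
      using le by (intro suminf_pos2[of _ k] summable_diff sum sum_d) (auto simp: less_le)
    then show ?thesis using suminf_diff[OF sum_d sum] sd by simp
  qed
qed

text \<open>Cauchy--Schwarz in the plane, for the vectors \<open>(sqrt a, sqrt b)\<close> and \<open>(sqrt c, sqrt d)\<close>.\<close>

lemma sqrt_add_sqrt_power2_le:
  fixes a b c d :: real
  assumes "a \<ge> 0" "b \<ge> 0" "c \<ge> 0" "d \<ge> 0"
  shows "(sqrt (a * c) + sqrt (b * d))\<^sup>2 \<le> (a + b) * (c + d)"
proof -
  have "sqrt ((a * d) * (b * c)) \<le> (a * d + b * c) / 2"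
    using assms by (intro arith_geo_mean_sqrt) auto
  moreover have "sqrt ((a * d) * (b * c)) = sqrt (a * c) * sqrt (b * d)"
    by (simp add: real_sqrt_mult)
  ultimately show ?thesis using assms by (simp add: power2_sum algebra_simps)
qed

section \<open>The objective as a product of real series\<close>

lemma objective_eq_ennreal:
  assumes "\<And>n. \<beta> n > 0" "\<And>n. t n > 0" "\<And>n. F n > 0"
    and "summable (\<lambda>n. \<beta> n / F n)" "summable (\<lambda>n. t n * F n)"
  shows "objective \<beta> t F = ennreal ((\<Sum>n. \<beta> n / F n) * (\<Sum>n. t n * F n))"
proof -
  have "(\<Sum>n. ennreal (\<beta> n / F n)) = ennreal (\<Sum>n. \<beta> n / F n)"
      "(\<Sum>n. ennreal (t n * F n)) = ennreal (\<Sum>n. t n * F n)"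
    by (rule suminf_ennreal2; simp add: assms less_imp_le)+
  then show ?thesis
    unfolding objective_def using assms
    by (simp add: ennreal_mult suminf_nonneg less_imp_le)
qed

text \<open>A product in \<^typ>\<open>ennreal\<close> can be finite with an infinite factor only if the other factor is
  \<open>0\<close>, and a series of positive terms is not.\<close>

lemma summable_if_objective_finite:
  assumes pos: "\<And>n. \<beta> n > 0" "\<And>n. t n > 0" "\<And>n. F n > 0"
    and fin: "objective \<beta> t F < top"
  shows "summable (\<lambda>n. \<beta> n / F n)" "summable (\<lambda>n. t n * F n)"
proof -
  have nz: "(\<Sum>n. ennreal (f n)) \<noteq> 0" if "\<And>n. f n > 0" for f :: "nat \<Rightarrow> real"
    using sum_le_suminf[of "\<lambda>n. ennreal (f n)" "{0}"] that[of 0] by auto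
  have "(\<Sum>n. ennreal (\<beta> n / F n)) \<noteq> top" "(\<Sum>n. ennreal (t n * F n)) \<noteq> top"
    using fin nz[of "\<lambda>n. \<beta> n / F n"] nz[of "\<lambda>n. t n * F n"] pos
    unfolding objective_def by (auto simp: ennreal_top_mult ennreal_mult_top)
  then show "summable (\<lambda>n. \<beta> n / F n)" "summable (\<lambda>n. t n * F n)"
    using pos by (auto intro!: summable_suminf_not_top simp: less_imp_le)
qed

section \<open>Uniqueness of the minimizer\<close>

lemma feasible_geometric_mean:
  assumes "feasible F" "feasible G"
  shows "feasible (\<lambda>n. sqrt (F n * G n))"
  using assms by (auto simp: feasible_def less_imp_le intro!: mult_mono)

text \<open>The logarithm of either factor of the objective is convex in \<open>ln F\<close>, so the geometric mean \<open>H\<close> of two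
  minimizers \<open>F\<close> and \<open>G\<close> is no worse than they are. It is strictly better unless \<open>F\<close> and \<open>G\<close> are
  proportional, and the normalization at \<open>0\<close> then makes them equal.\<close>

lemma minimizer_unique:
  assumes pos: "\<And>n. \<beta> n > 0" "\<And>n. t n > 0"
    and F: "is_arg_min (objective \<beta> t) feasible F"
    and G: "is_arg_min (objective \<beta> t) feasible G"
    and fin: "objective \<beta> t G < top"
  shows "F = G"
proof (rule ccontr)
  assume "F \<noteq> G"
  have feas: "feasible F" "feasible G" using F G by (auto simp: is_arg_min_def)
  then have FG: "F n > 0" "G n > 0" "F 0 = 1" "G 0 = 1" for n by (auto simp: feasible_def)
  have eq: "objective \<beta> t F = objective \<beta> t G"
    using F G by (auto simp: is_arg_min_def not_less intro: antisym)
  note sG = summable_if_objective_finite[of \<beta> t G, OF pos FG(2) fin]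
  have sF: "summable (\<lambda>n. \<beta> n / F n)" "summable (\<lambda>n. t n * F n)"
    using summable_if_objective_finite[of \<beta> t F, OF pos FG(1)] fin unfolding eq by auto
  define A B where "A F = (\<Sum>n. \<beta> n / F n)" and "B F = (\<Sum>n. t n * F n)"
    for F :: "nat \<Rightarrow> real"
  have AB: "A F > 0" "B F > 0" "A G > 0" "B G > 0"
    unfolding A_def B_def using sF sG pos FG by (auto intro: suminf_pos)
  define H where "H n = sqrt (F n * G n)" for n
  have H: "feasible H"
    unfolding H_def using feas by (rule feasible_geometric_mean)
  then have Hpos: "H n > 0" for n by (simp add: feasible_def)
  have tH: "t n * H n = sqrt ((t n * F n) * (t n * G n))" for n
  proof -
    have "(t n * F n) * (t n * G n) = (t n)\<^sup>2 * (F n * G n)" by (simp add: power2_eq_square)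
    then show ?thesis using pos[of n] by (simp add: H_def real_sqrt_mult)
  qed
  have bH: "\<beta> n / H n = sqrt ((\<beta> n / F n) * (\<beta> n / G n))" for n
  proof -
    have "(\<beta> n / F n) * (\<beta> n / G n) = (\<beta> n)\<^sup>2 / (F n * G n)" by (simp add: power2_eq_square)
    then show ?thesis using pos[of n] by (simp add: H_def real_sqrt_divide)
  qed
  have sH: "summable (\<lambda>n. \<beta> n / H n)" "summable (\<lambda>n. t n * H n)"
    unfolding tH bH
    by (rule summable_sqrt_mult[OF _ _ sF(1) sG(1)] summable_sqrt_mult[OF _ _ sF(2) sG(2)];
        simp add: pos FG)+
  have AH: "A H \<le> sqrt (A F * A G)"
    unfolding A_def bH by (rule suminf_sqrt_mult_le[OF _ _ sF(1) sG(1)]; simp add: pos FG)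
  \<comment> \<open>Equality in the second estimate would force proportionality; index \<open>0\<close> fixes the factor.\<close>
  obtain k where k: "t k * F k * B G \<noteq> t k * G k * B F"
  proof (rule ccontr)
    assume "\<not> thesis"
    then have *: "t k * F k * B G = t k * G k * B F" for k using that by blast
    have "B G = B F" using *[of 0] FG pos[of 0] by simp
    then have "F k = G k" for k using *[of k] AB pos[of k] by simp
    then show False using \<open>F \<noteq> G\<close> by auto
  qed
  have BH: "B H < sqrt (B F * B G)"
    unfolding B_def tH using sF sG pos FG k
    by (auto intro!: suminf_sqrt_mult_less[of _ _ k] simp: B_def)
  have obj: "objective \<beta> t F = ennreal (A F * B F)" "objective \<beta> t G = ennreal (A G * B G)"
      "objective \<beta> t H = ennreal (A H * B H)"
    unfolding A_def B_def using sF sG sH pos FG Hpos by (auto intro!: objective_eq_ennreal)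
  have "A H > 0" "B H > 0"
    unfolding A_def B_def using sH pos Hpos by (auto intro!: suminf_pos)
  then have "A H * B H < sqrt (A F * A G) * sqrt (B F * B G)"
    using AH BH AB by (intro mult_le_less_imp_less) auto
  also have "\<dots> = sqrt ((A F * B F) * (A G * B G))"
    by (simp add: real_sqrt_mult ac_simps)
  also have "A F * B F = A G * B G"
    using eq AB unfolding obj by simp
  also have "sqrt ((A G * B G) * (A G * B G)) = A G * B G" using AB by simp
  finally have "objective \<beta> t H < objective \<beta> t G"
    unfolding obj using AB \<open>A H > 0\<close> \<open>B H > 0\<close> by (simp add: ennreal_less_iff)
  then show False using G H by (auto simp: is_arg_min_def)
qed

section \<open>Extending a truncated minimizer\<close>

text \<open>The first-order condition for the last coordinate, arranged so as to say that
  \<open>A / B = (\<beta> m / Fm m) / (t m * Fm m)\<close> for the two truncated sums \<open>A\<close> and \<open>B\<close>: head and last entry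
  have the same ratio. Lowering the last coordinate keeps the vector feasible, and so does raising it
  slightly because \<open>Fm (m - 1) > Fm m\<close>; hence \<open>Fm m\<close> is an interior minimum.\<close>

lemma truncated_stationarity:
  assumes m: "m \<ge> 1" and pos: "\<And>n. \<beta> n > 0" "\<And>n. t n > 0"
    and min: "is_arg_min (trunc_objective m \<beta> t) (trunc_feasible m) Fm"
    and free: "Fm (m - 1) \<noteq> Fm m"
  shows "(\<Sum>n=0..m. \<beta> n / Fm n) * (t m * (Fm m)\<^sup>2) = \<beta> m * (\<Sum>n=0..m. t n * Fm n)"
proof -
  obtain j where j: "m = Suc j" using m by (cases m) auto
  define a b where "a = (\<Sum>n=0..j. \<beta> n / Fm n)" and "b = (\<Sum>n=0..j. t n * Fm n)"
  define f where "f x = (a + \<beta> m / x) * (b + t m * x)" for x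
  define z where "z = Fm m"
  have feas: "trunc_feasible m Fm" using min by (simp add: is_arg_min_def)
  then have z: "z > 0" "z < Fm j"
    using free j unfolding trunc_feasible_def z_def by (auto simp: less_le)
  have upd: "trunc_objective m \<beta> t (Fm(m := x)) = f x" for x
    by (simp add: trunc_objective_def f_def a_def b_def j)
  have le: "f z \<le> f x" if "0 < x" "x < Fm j" for x
  proof -
    have "trunc_feasible m (Fm(m := x))"
      using feas that j by (auto simp: trunc_feasible_def less_Suc_eq)
    then have "trunc_objective m \<beta> t (Fm(m := z)) \<le> trunc_objective m \<beta> t (Fm(m := x))"
      using min unfolding z_def by (auto simp: is_arg_min_def not_less)
    then show ?thesis unfolding upd .
  qed
  have "(f has_real_derivative (a + \<beta> m / z) * t m - \<beta> m / z\<^sup>2 * (b + t m * z)) (at z)"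
    unfolding f_def using z by (auto intro!: derivative_eq_intros simp: power2_eq_square)
  moreover have "(a + \<beta> m / z) * t m - \<beta> m / z\<^sup>2 * (b + t m * z) = a * t m - b * \<beta> m / z\<^sup>2"
    using z by (simp add: field_simps power2_eq_square)
  ultimately have der: "(f has_real_derivative (a * t m - b * \<beta> m / z\<^sup>2)) (at z)" by simp
  have "a * t m - b * \<beta> m / z\<^sup>2 = 0"
  proof (rule DERIV_local_min[OF der, of "min z (Fm j - z)"])
    show "\<forall>y. \<bar>z - y\<bar> < min z (Fm j - z) \<longrightarrow> f z \<le> f y"
      using le by (auto simp: abs_if split: if_splits)
  qed (use z in auto)
  then have "a * t m * z\<^sup>2 = b * \<beta> m" using z by (simp add: field_simps)
  moreover have sums: "(\<Sum>n=0..m. \<beta> n / Fm n) = a + \<beta> m / z"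
      "(\<Sum>n=0..m. t n * Fm n) = b + t m * z"
    by (simp_all add: a_def b_def j z_def)
  ultimately show ?thesis using z unfolding sums unfolding z_def[symmetric]
    by (simp add: field_simps power2_eq_square)
qed

lemma suminf_split_truncation:
  fixes f :: "nat \<Rightarrow> real"
  assumes "summable f"
  shows "suminf f = (\<Sum>n=0..m. f n) + (\<Sum>n. f (n + Suc m))"
  using suminf_split_initial_segment[OF assms, of "Suc m"]
  by (simp add: atLeast0AtMost lessThan_Suc_atMost)

text \<open>The constraints enter only through the head, which is a competitor in the truncated problem.
  On the tail, \<open>F\<close> cancels from the products \<open>(\<beta> n / F n) * (t n * F n)\<close> that Cauchy--Schwarz
  leaves.\<close>

lemma objective_lower_bound:
  assumes pos: "\<And>n. \<beta> n > 0" "\<And>n. t n > 0"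
    and min: "is_arg_min (trunc_objective m \<beta> t) (trunc_feasible m) Fm"
    and F: "feasible F"
  shows "ennreal ((sqrt (trunc_objective m \<beta> t Fm)
           + (\<Sum>n. sqrt (\<beta> (n + Suc m) * t (n + Suc m))))\<^sup>2) \<le> objective \<beta> t F"
proof (cases "objective \<beta> t F < top")
  case True
  have Fpos: "F n > 0" for n using F by (simp add: feasible_def)
  note sF = summable_if_objective_finite[of \<beta> t F, OF pos Fpos True]
  define a a' where "a = (\<Sum>n=0..m. \<beta> n / F n)" and "a' = (\<Sum>n. \<beta> (n + Suc m) / F (n + Suc m))"
  define b b' where "b = (\<Sum>n=0..m. t n * F n)" and "b' = (\<Sum>n. t (n + Suc m) * F (n + Suc m))"
  have sT: "summable (\<lambda>n. \<beta> (n + Suc m) / F (n + Suc m))"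
      "summable (\<lambda>n. t (n + Suc m) * F (n + Suc m))"
    using sF[THEN summable_ignore_initial_segment, of "Suc m"] .
  have nonneg: "a \<ge> 0" "a' \<ge> 0" "b \<ge> 0" "b' \<ge> 0"
    unfolding a_def a'_def b_def b'_def
    by (auto intro!: sum_nonneg suminf_nonneg sT[simplified] simp: pos Fpos less_imp_le)
  have "trunc_feasible m F" using F by (auto simp: feasible_def trunc_feasible_def)
  then have head: "trunc_objective m \<beta> t Fm \<le> a * b"
    using min by (auto simp: is_arg_min_def not_less trunc_objective_def a_def b_def)
  have Fm0: "trunc_objective m \<beta> t Fm \<ge> 0"
    using min unfolding trunc_objective_def is_arg_min_def trunc_feasible_def
    by (intro mult_nonneg_nonneg sum_nonneg) (auto simp: pos less_imp_le)
  define S where "S = (\<Sum>n. sqrt (\<beta> (n + Suc m) * t (n + Suc m)))"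
  have root: "sqrt (\<beta> n * t n) = sqrt ((\<beta> n / F n) * (t n * F n))" for n
    using Fpos[of n] by simp
  have tail: "S \<le> sqrt (a' * b')"
    unfolding S_def a'_def b'_def root
    by (rule suminf_sqrt_mult_le[OF _ _ sT]) (auto simp: pos Fpos)
  have S0: "0 \<le> S"
    unfolding S_def root
    by (rule suminf_nonneg[OF summable_sqrt_mult[OF _ _ sT]]) (auto simp: pos Fpos less_imp_le)
  have "(sqrt (trunc_objective m \<beta> t Fm) + S)\<^sup>2 \<le> (sqrt (a * b) + sqrt (a' * b'))\<^sup>2"
    using head tail S0 Fm0 by (intro power_mono add_mono real_sqrt_le_mono) auto
  also have "\<dots> \<le> (a + a') * (b + b')"
    using nonneg by (intro sqrt_add_sqrt_power2_le)
  finally show ?thesis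
    unfolding objective_eq_ennreal[of \<beta> t F, OF pos Fpos sF] S_def[symmetric]
    unfolding suminf_split_truncation[OF sF(1), of m] suminf_split_truncation[OF sF(2), of m]
    by (intro ennreal_leI) (simp add: a_def a'_def b_def b'_def)
next
  case False
  then have "objective \<beta> t F = top" by (simp add: less_top[symmetric])
  then show ?thesis by simp
qed

text \<open>The tail is the multiple of \<open>sqrt (\<beta> n / t n)\<close>, the equality case of Cauchy--Schwarz, that takes
  the value \<open>Fm m\<close> at \<open>m\<close>. Unlike a recursion by the ratio of consecutive terms, the closed form
  shows this proportionality.\<close>

definition extend_by_root :: "nat \<Rightarrow> (nat \<Rightarrow> real) \<Rightarrow> (nat \<Rightarrow> real) \<Rightarrow> (nat \<Rightarrow> real) \<Rightarrow> nat \<Rightarrow> real"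
  where "extend_by_root m \<beta> t Fm n =
    (if n \<le> m then Fm n else Fm m * sqrt ((\<beta> n / t n) / (\<beta> m / t m)))"

lemma extend_by_root_ge:
  assumes "\<beta> m > 0" "t m > 0" "n \<ge> m"
  shows "extend_by_root m \<beta> t Fm n = Fm m * sqrt ((\<beta> n / t n) / (\<beta> m / t m))"
  using assms by (cases "n = m") (auto simp: extend_by_root_def)

lemma feasible_extend_by_root:
  assumes pos: "\<And>n. \<beta> n > 0" "\<And>n. t n > 0"
    and dec: "\<And>n. n \<ge> m \<Longrightarrow> \<beta> (Suc n) / t (Suc n) \<le> \<beta> n / t n"
    and feas: "trunc_feasible m Fm"
  shows "feasible (extend_by_root m \<beta> t Fm)"
  unfolding feasible_def
proof (intro conjI allI)
  fix n
  have Fm: "Fm m > 0" using feas by (simp add: trunc_feasible_def)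
  show "extend_by_root m \<beta> t Fm n > 0"
    using feas pos Fm by (auto simp: extend_by_root_def trunc_feasible_def)
  show "extend_by_root m \<beta> t Fm (Suc n) \<le> extend_by_root m \<beta> t Fm n"
  proof (cases "n < m")
    case True
    then show ?thesis using feas by (auto simp: extend_by_root_def trunc_feasible_def)
  next
    case False
    then have "sqrt ((\<beta> (Suc n) / t (Suc n)) / (\<beta> m / t m)) \<le> sqrt ((\<beta> n / t n) / (\<beta> m / t m))"
      using pos[of m] dec[of n] by (intro real_sqrt_le_mono divide_right_mono) auto
    with False show ?thesis
      using Fm pos
      by (simp add: extend_by_root_ge mult_left_mono
          del: divide_divide_eq_left divide_divide_eq_right real_sqrt_le_iff)
  qed
qed (use feas in \<open>auto simp: extend_by_root_def trunc_feasible_def\<close>)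

text \<open>For the constant \<open>k\<close> below, tail terms satisfy \<open>\<beta> n / G n = k * sqrt (\<beta> n * t n)\<close> and
  \<open>t n * G n = sqrt (\<beta> n * t n) / k\<close>, and stationarity says that the head sums satisfy
  \<open>a = k\<^sup>2 * b\<close>. With \<open>S\<close> the sum of the \<open>sqrt (\<beta> n * t n)\<close> over the tail, the objective is
  therefore \<open>(k\<^sup>2 * b + k * S) * (b + S / k) = (k * b + S)\<^sup>2\<close>, where \<open>k * b = sqrt (a * b)\<close>.\<close>

lemma extend_by_root_attains_bound:
  assumes m: "m \<ge> 1" and pos: "\<And>n. \<beta> n > 0" "\<And>n. t n > 0"
    and summ: "summable (\<lambda>n. sqrt (\<beta> n * t n))"
    and min: "is_arg_min (trunc_objective m \<beta> t) (trunc_feasible m) Fm"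
    and free: "Fm (m - 1) \<noteq> Fm m"
  shows "objective \<beta> t (extend_by_root m \<beta> t Fm) =
    ennreal ((sqrt (trunc_objective m \<beta> t Fm)
           + (\<Sum>n. sqrt (\<beta> (n + Suc m) * t (n + Suc m))))\<^sup>2)"
proof -
  define G where "G = extend_by_root m \<beta> t Fm"
  have feas: "trunc_feasible m Fm" using min by (simp add: is_arg_min_def)
  have z: "Fm m > 0" using feas by (simp add: trunc_feasible_def)
  have Gpos: "G n > 0" for n
    using feas pos z by (auto simp: G_def extend_by_root_def trunc_feasible_def)
  define a b where "a = (\<Sum>n=0..m. \<beta> n / Fm n)" and "b = (\<Sum>n=0..m. t n * Fm n)"
  have ab: "a > 0" "b > 0"
    unfolding a_def b_def using feas pos
    by (auto intro!: sum_pos simp: trunc_feasible_def)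
  define k where "k = sqrt (\<beta> m / t m) / Fm m"
  have k: "k > 0" using z pos by (simp add: k_def)
  have kk: "a = k\<^sup>2 * b"
    using truncated_stationarity[OF m pos min free] z pos[of m]
    unfolding a_def[symmetric] b_def[symmetric]
    by (simp add: k_def power_divide field_simps)
  have tG: "t n * G n = sqrt (\<beta> n * t n) / k" if "n > m" for n
  proof -
    have "G n = sqrt (\<beta> n / t n) / k"
      using that by (simp add: G_def extend_by_root_def k_def real_sqrt_divide real_sqrt_mult)
    moreover have "t n * sqrt (\<beta> n / t n) = sqrt (\<beta> n * t n)"
      using pos[of n] by (simp add: real_sqrt_divide real_sqrt_mult real_div_sqrt field_simps)
    ultimately show ?thesis by (simp add: field_simps)
  qed
  have bG: "\<beta> n / G n = sqrt (\<beta> n * t n) * k" if "n > m" for n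
  proof -
    define s where "s = sqrt (\<beta> n * t n)"
    have s: "s > 0" "s * s = \<beta> n * t n" using pos[of n] by (simp_all add: s_def)
    have "\<beta> n / G n = s * s / (t n * G n)"
      using pos[of n] by (simp add: s)
    also have "\<dots> = s * k"
      using s(1) k by (simp add: tG[OF that] flip: s_def)
    finally show ?thesis by (simp add: s_def)
  qed
  define S where "S = (\<Sum>n. sqrt (\<beta> (n + Suc m) * t (n + Suc m)))"
  have sS: "summable (\<lambda>n. sqrt (\<beta> (n + Suc m) * t (n + Suc m)))"
    by (rule summable_ignore_initial_segment[OF summ])
  have "summable (\<lambda>n. \<beta> (n + Suc m) / G (n + Suc m))"
      "summable (\<lambda>n. t (n + Suc m) * G (n + Suc m))"
    using summable_mult2[OF sS, of k] summable_divide[OF sS, of k] by (simp_all add: tG bG)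
  then have sG: "summable (\<lambda>n. \<beta> n / G n)" "summable (\<lambda>n. t n * G n)"
    using summable_iff_shift[of "\<lambda>n. \<beta> n / G n" "Suc m"]
      summable_iff_shift[of "\<lambda>n. t n * G n" "Suc m"] by blast+
  have A: "(\<Sum>n. \<beta> n / G n) = a + S * k"
    unfolding suminf_split_truncation[OF sG(1), of m] a_def S_def suminf_mult2[OF sS]
    by (simp add: bG) (simp add: G_def extend_by_root_def)
  have B: "(\<Sum>n. t n * G n) = b + S / k"
    unfolding suminf_split_truncation[OF sG(2), of m] b_def S_def suminf_divide[OF sS]
    by (simp add: tG suminf_divide[OF sS, simplified])
      (simp add: G_def extend_by_root_def)
  have root: "sqrt (trunc_objective m \<beta> t Fm) = k * b"
    using k ab unfolding trunc_objective_def a_def[symmetric] b_def[symmetric] kk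
    by (intro real_sqrt_unique) (auto simp: power2_eq_square)
  have "(a + S * k) * (b + S / k) = (k * b + S)\<^sup>2"
    using k by (simp add: kk power2_eq_square field_simps)
  then show ?thesis
    unfolding root S_def[symmetric] G_def[symmetric]
    by (simp add: objective_eq_ennreal[of \<beta> t G, OF pos Gpos sG] A B)
qed

text \<open>The extension attains the lower bound, so it is a minimizer, and its value is finite; uniqueness
  identifies it with any other minimizer.\<close>

lemma infinite_minimizer_eq_extend_by_root:
  assumes m: "m \<ge> 1" and pos: "\<And>n. \<beta> n > 0" "\<And>n. t n > 0"
    and dec: "\<And>n. n \<ge> m \<Longrightarrow> \<beta> (Suc n) / t (Suc n) \<le> \<beta> n / t n"
    and summ: "summable (\<lambda>n. sqrt (\<beta> n * t n))"
    and F: "is_arg_min (objective \<beta> t) feasible F"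
    and min: "is_arg_min (trunc_objective m \<beta> t) (trunc_feasible m) Fm"
    and free: "Fm (m - 1) \<noteq> Fm m"
  shows "F = extend_by_root m \<beta> t Fm"
proof (rule minimizer_unique[OF pos F])
  have val: "objective \<beta> t (extend_by_root m \<beta> t Fm) =
    ennreal ((sqrt (trunc_objective m \<beta> t Fm)
           + (\<Sum>n. sqrt (\<beta> (n + Suc m) * t (n + Suc m))))\<^sup>2)"
    by (intro extend_by_root_attains_bound m pos summ min free)
  have "trunc_feasible m Fm" using min by (simp add: is_arg_min_def)
  then have "feasible (extend_by_root m \<beta> t Fm)"
    by (intro feasible_extend_by_root pos dec)
  then show "is_arg_min (objective \<beta> t) feasible (extend_by_root m \<beta> t Fm)"
    using objective_lower_bound[of \<beta> t, OF pos min] unfolding is_arg_min_def val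
    by (auto simp: not_less)
  show "objective \<beta> t (extend_by_root m \<beta> t Fm) < top" unfolding val by simp
qed

section \<open>Geometric weights\<close>

text \<open>The bound on \<open>\<beta>\<close> makes the terms \<open>O(q ^ n)\<close> with \<open>q = 2 powr (1 / 2 - p)\<close>, and \<open>q < 1\<close> is the
  condition \<open>p > 1 / 2\<close>.\<close>

lemma summable_sqrt_geometric_weights:
  fixes \<beta> :: "nat \<Rightarrow> real"
  assumes p: "p > 1 / 2" and pos: "\<And>n. \<beta> n > 0" and O: "\<beta> \<in> O(\<lambda>n. 2 powr (- 2 * p * real n))"
  shows "summable (\<lambda>n. sqrt (\<beta> n * 2 ^ n))"
proof -
  obtain C where C: "C > 0" "\<forall>\<^sub>F n in sequentially. norm (\<beta> n) \<le> C * norm (2 powr (- 2 * p * real n))"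
    using O by (rule landau_o.bigE)
  define q :: real where "q = 2 powr (1 / 2 - p)"
  have "q < 1" "q > 0" using p by (auto simp: q_def powr_less_one)
  have qn: "2 powr (- 2 * p * real n) * 2 ^ n = (q ^ n)\<^sup>2" for n
  proof -
    have "(2::real) powr (- 2 * p * real n) * 2 ^ n = 2 powr (- 2 * p * real n + real n)"
      by (simp only: powr_add powr_realpow zero_less_numeral)
    also have "- 2 * p * real n + real n = real (n * 2) * (1 / 2 - p)"
      by (simp add: algebra_simps)
    also have "(2::real) powr \<dots> = q ^ (n * 2)"
      unfolding q_def by (rule powr_power[symmetric]) simp
    finally show ?thesis by (simp add: power_mult)
  qed
  have "\<forall>\<^sub>F n in sequentially. norm (sqrt (\<beta> n * 2 ^ n)) \<le> sqrt C * q ^ n"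
    using C(2)
  proof eventually_elim
    case (elim n)
    then have "\<beta> n * 2 ^ n \<le> C * (q ^ n)\<^sup>2"
      unfolding qn[symmetric] by simp
    then have "sqrt (\<beta> n * 2 ^ n) \<le> sqrt (C * (q ^ n)\<^sup>2)" by (rule real_sqrt_le_mono)
    then show ?case using \<open>q > 0\<close> pos[of n] by (simp add: real_sqrt_mult)
  qed
  moreover have "summable (\<lambda>n. sqrt C * q ^ n)"
    using \<open>q < 1\<close> \<open>q > 0\<close> by (intro summable_mult summable_geometric) auto
  ultimately show ?thesis by (rule summable_comparison_test_ev)
qed

text \<open>The ratio condition serves to make \<open>\<beta> n / t n\<close> decreasing from \<open>m\<close> on: since \<open>4 powr p > 2\<close> and
  \<open>\<epsilon> < 1\<close>, it forces \<open>\<beta> n / \<beta> (n + 1) > 1\<close>. The recursion in the conclusion is then the ratio of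
  consecutive values of \<open>sqrt (\<beta> n / 2 ^ n)\<close>.\<close>

theorem theorem4p1:
  fixes p \<epsilon> :: real and m :: nat and t \<beta> F Fm :: "nat \<Rightarrow> real"
  assumes "p > 1 / 2" and "0 < \<epsilon>" and "\<epsilon> < 1" and "m \<ge> 1"
    and "\<And>n. t n = 2 ^ n"
    and "\<And>n. \<beta> n > 0"
    and "\<beta> \<in> O(\<lambda>n. 2 powr (- 2 * p * real n))"
    and "\<And>n. n \<ge> m \<Longrightarrow> 4 powr p - \<epsilon> < \<beta> n / \<beta> (n + 1) \<and> \<beta> n / \<beta> (n + 1) < 4 powr p + \<epsilon>"
    and "is_arg_min (objective \<beta> t) feasible F"
    and "is_arg_min (trunc_objective m \<beta> t) (trunc_feasible m) Fm"
    and "Fm (m - 1) \<noteq> Fm m"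
  shows "(\<forall>n\<le>m. F n = Fm n) \<and>
         (\<forall>n\<ge>m. F (n + 1) = F n * sqrt (\<beta> (n + 1) / (2 * \<beta> n)))"
proof -
  note beta_pos = assms(6)
  have t_pos: "t n > 0" for n by (simp add: assms(5))
  have "2 = (4::real) powr (1 / 2)" by (simp add: powr_half_sqrt)
  also have "\<dots> < 4 powr p" by (rule powr_less_mono) (use assms(1) in auto)
  finally have p2: "4 powr p > 2" .
  have dec: "\<beta> (Suc n) / t (Suc n) \<le> \<beta> n / t n" if "n \<ge> m" for n
  proof -
    have "1 < \<beta> n / \<beta> (n + 1)" using assms(8)[OF that] p2 assms(3) by simp
    then have "\<beta> (Suc n) \<le> \<beta> n" using beta_pos[of "Suc n"] by (simp add: field_simps)
    then have "\<beta> (Suc n) \<le> 2 * \<beta> n" using beta_pos[of n] by linarith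
    then show ?thesis by (simp add: assms(5) field_simps)
  qed
  have "summable (\<lambda>n. sqrt (\<beta> n * t n))"
    unfolding assms(5) by (rule summable_sqrt_geometric_weights[OF assms(1,6,7)])
  then have F: "F = extend_by_root m \<beta> t Fm"
    using assms(4,9-11) beta_pos t_pos dec
    by (intro infinite_minimizer_eq_extend_by_root)
  have "F (n + 1) = F n * sqrt (\<beta> (n + 1) / (2 * \<beta> n))" if "n \<ge> m" for n
  proof -
    have "(\<beta> (n + 1) / t (n + 1)) / (\<beta> m / t m)
        = (\<beta> n / t n) / (\<beta> m / t m) * (\<beta> (n + 1) / (2 * \<beta> n))"
      using beta_pos[of n] by (simp add: assms(5) ac_simps)
    then have "sqrt ((\<beta> (n + 1) / t (n + 1)) / (\<beta> m / t m))
        = sqrt ((\<beta> n / t n) / (\<beta> m / t m)) * sqrt (\<beta> (n + 1) / (2 * \<beta> n))"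
      by (simp only: real_sqrt_mult)
    moreover have "n + 1 \<ge> m" using that by simp
    ultimately show ?thesis
      using that
      by (simp only: F extend_by_root_ge[OF beta_pos t_pos] mult.assoc)
  qed
  moreover have "\<forall>n\<le>m. F n = Fm n" by (simp add: F extend_by_root_def)
  ultimately show ?thesis by blast
qed

end
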